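(* For $0<t=t(n)<n/2$ there exist secure sketches $(\mathsf{SS},\mathsf{Rec})$ for $\{0,1\}^n$ with entropy loss $n(h(t/n)+o(1))$ which correct any $t$ flipped bits with high probability in the input-dependent error model; that is, for every pair $w,w'\in\{0,1\}^n$ at Hamming distance at most $t$, $\Pr[\mathsf{Rec}(w',\mathsf{SS}(w))=w]\ge1-o(1)$ as $n\to\infty$, the probability being over the coins of $\mathsf{SS}$.
   Context: Logarithms are base 2; $h(p)=-p\log p-(1-p)\log(1-p)$. Min-entropy: $\mathbf{H}_\infty(A)=-\log\max_a\Pr[A=a]$; average min-entropy: $\tilde{\mathbf{H}}_\infty(A\mid B)=-\log\big(\mathbb{E}_{b\leftarrow B}[\max_a\Pr[A=a\mid B=b]]\big)$. A secure sketch here is a pair of procedures: randomized $\mathsf{SS}:\{0,1\}^n\to\{0,1\}^*$ and $\mathsf{Rec}:\{0,1\}^n\times\{0,1\}^*\to\{0,1\}^n$, with the usual worst-case correctness requirement replaced by the probabilistic one in the claim: the corrupted word $w'$ may depend on $w$ arbitrarily but not on the output (coins) of $\mathsf{SS}$. It has entropy loss $\lambda$ if for every $m$ and every distribution $W$ on $\{0,1\}^n$ with min-entropy at least $m$, $\tilde{\mathbf{H}}_\infty(W\mid\mathsf{SS}(W))\ge m-\lambda$. *)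

theory Defs
  imports "HOL-Probability.Probability" "HOL-Library.Landau_Symbols"
begin

definition words :: "nat \<Rightarrow> bool list set" where
  "words n = {w. length w = n}"

text \<open>Only meaningful for words of equal length.\<close>

definition hamming :: "bool list \<Rightarrow> bool list \<Rightarrow> nat" where
  "hamming w w' = card {i. i < length w \<and> w ! i \<noteq> w' ! i}"

definition bin_entropy :: "real \<Rightarrow> real" where
  "bin_entropy p = - p * log 2 p - (1 - p) * log 2 (1 - p)"

text \<open>
  The supremum of the point masses of a discrete distribution is always attained, so
  the suprema below are the maxima of the usual definitions (for \<open>avg_min_entropy\<close>, at
  every \<open>b\<close> of positive probability; the others do not contribute to the expectation).
\<close>

definition min_entropy :: "'a pmf \<Rightarrow> real" where
  "min_entropy A = - log 2 (SUP a. pmf A a)"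

text \<open>The argument is the joint distribution of the pair \<open>(A, B)\<close>.\<close>

definition avg_min_entropy :: "('a \<times> 'b) pmf \<Rightarrow> real" where
  "avg_min_entropy P =
     - log 2 (measure_pmf.expectation (map_pmf snd P)
         (\<lambda>b. SUP a. \<P>(x in measure_pmf P. fst x = a \<bar> snd x = b)))"

definition sketch_joint ::
    "bool list pmf \<Rightarrow> (bool list \<Rightarrow> bool list pmf) \<Rightarrow> (bool list \<times> bool list) pmf" where
  "sketch_joint W SS = bind_pmf W (\<lambda>w. map_pmf (\<lambda>s. (w, s)) (SS w))"

definition has_entropy_loss :: "nat \<Rightarrow> (bool list \<Rightarrow> bool list pmf) \<Rightarrow> real \<Rightarrow> bool" where
  "has_entropy_loss n SS loss \<longleftrightarrow>
     (\<forall>m::real. \<forall>W. set_pmf W \<subseteq> words n \<longrightarrow> min_entropy W \<ge> m \<longrightarrow>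
        avg_min_entropy (sketch_joint W SS) \<ge> m - loss)"

text \<open>
  In the input-dependent error model the corrupted word is chosen knowing \<open>w\<close> but not the
  coins of \<open>SS\<close>, hence \<open>w'\<close> is quantified outside the probability.
\<close>

definition corrects_input_dependent ::
    "nat \<Rightarrow> nat \<Rightarrow> (bool list \<Rightarrow> bool list pmf) \<Rightarrow> (bool list \<Rightarrow> bool list \<Rightarrow> bool list)
      \<Rightarrow> real \<Rightarrow> bool" where
  "corrects_input_dependent n t SS Rec err \<longleftrightarrow>
     (\<forall>w\<in>words n. \<forall>w'\<in>words n. hamming w w' \<le> t \<longrightarrow>
        \<P>(s in measure_pmf (SS w). Rec w' s = w) \<ge> 1 - err)"

end

(* The sketch of w is a uniformly random function f from words to {..<K} together with the
   hash value f w.  The function is independent of w, so only the hash value costs entropy, at most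
   log K.  Decoding searches the Hamming ball of radius t around w' for a word with the right hash
   value; it fails only if f collides at w and another word of that ball, which has probability at
   most V / K, where V is the volume of the ball.  Since V <= 2^(n h(t/n)), taking
   K = n V gives loss n h(t/n) + log n and error 1/n. *)

theory Submission
  imports Defs "HOL-Real_Asymp.Real_Asymp"
begin

section \<open>Average min-entropy of sketches\<close>

text \<open>When \<open>b\<close> has probability 0, both sides are 0 by the convention on
  division.\<close>

lemma cond_prob_pmf_fst_snd:
  "\<P>(x in measure_pmf P. fst x = a \<bar> snd x = b) = pmf P (a, b) / pmf (map_pmf snd P) b"
proof -
  have "{x. fst x = a \<and> snd x = b} = {(a, b)}" by auto
  then show ?thesis
    by (simp add: cond_prob_def pmf_map vimage_def measure_pmf_single)
qed

text \<open>In the expectation over \<open>b\<close> the weight of \<open>b\<close> cancels the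
  denominator of the conditional probability. What remains is a sum over \<open>B\<close> of largest
  joint masses, each at most \<open>c\<close>.\<close>

lemma avg_min_entropy_ge:
  fixes P :: "('a \<times> 'b) pmf"
  assumes fin: "finite B" and supp: "snd ` set_pmf P \<subseteq> B"
    and le: "\<And>a b. pmf P (a, b) \<le> c"
  shows "avg_min_entropy P \<ge> - log 2 (real (card B) * c)"
proof -
  let ?Q = "map_pmf snd P"
  define G where "G b = (SUP a. pmf P (a, b) / pmf ?Q b)" for b
  have point_le: "pmf P (a, b) \<le> pmf ?Q b" for a b
  proof -
    have "measure_pmf.prob P {(a, b)} \<le> measure_pmf.prob P (snd -` {b})"
      by (intro measure_pmf.finite_measure_mono) auto
    then show ?thesis by (simp add: pmf_map measure_pmf_single)
  qed
  have bdd: "bdd_above (range (\<lambda>a. pmf P (a, b) / pmf ?Q b))" for b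
    by (rule bdd_aboveI[of _ 1]) (auto simp: divide_le_eq_1 point_le pmf_nonneg less_le)
  have upper: "pmf P (a, b) / pmf ?Q b \<le> G b" for a b
    unfolding G_def by (rule cSUP_upper[OF _ bdd]) simp
  have G_nonneg: "0 \<le> G b" for b
    using upper[of undefined b] by (meson divide_nonneg_nonneg order_trans pmf_nonneg)
  have c0: "0 \<le> c" by (meson le order_trans pmf_nonneg)
  have term_le: "pmf ?Q b * G b \<le> c" for b
  proof (cases "pmf ?Q b = 0")
    case False
    then have pos: "pmf ?Q b > 0" by (simp add: less_le pmf_nonneg)
    have "G b \<le> c / pmf ?Q b"
      unfolding G_def by (rule cSUP_least) (auto intro!: divide_right_mono le)
    then show ?thesis using pos by (simp add: field_simps)
  qed (simp add: c0)
  \<comment> \<open>A point of the support makes the expectation strictly positive, so that the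
    logarithm can be applied monotonically.\<close>
  obtain a0 b0 where ab: "(a0, b0) \<in> set_pmf P"
    using set_pmf_not_empty[of P] by fastforce
  have p0: "pmf P (a0, b0) > 0" using ab by (simp add: pmf_positive_iff)
  then have q0: "pmf ?Q b0 > 0" using point_le[of a0 b0] by linarith
  have "G b0 > 0" using upper[of a0 b0] p0 q0 by (meson divide_pos_pos less_le_trans)
  have int: "measure_pmf.expectation ?Q G = (\<Sum>b\<in>B. pmf ?Q b * G b)"
    using supp by (subst integral_measure_pmf[OF fin]) auto
  have pos: "0 < (\<Sum>b\<in>B. pmf ?Q b * G b)"
    using ab supp q0 \<open>G b0 > 0\<close> G_nonneg
    by (intro sum_pos2[OF fin, of b0]) (force simp del: pmf_map)+
  have "(\<Sum>b\<in>B. pmf ?Q b * G b) \<le> real (card B) * c"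
    using sum_bounded_above[of B "\<lambda>b. pmf ?Q b * G b" c] term_le by simp
  with pos have "log 2 (\<Sum>b\<in>B. pmf ?Q b * G b) \<le> log 2 (real (card B) * c)"
    by simp
  then show ?thesis
    unfolding avg_min_entropy_def cond_prob_pmf_fst_snd G_def[symmetric] using int by simp
qed

lemma pmf_sketch_joint: "pmf (sketch_joint W SS) (w, s) = pmf W w * pmf (SS w) s"
proof -
  have inner: "pmf (map_pmf (Pair v) (SS v)) (w, s) = indicator {w} v * pmf (SS w) s" for v
  proof (cases "v = w")
    case True
    then show ?thesis by (simp add: pmf_map_inj' inj_def)
  next
    case False
    then show ?thesis by (auto simp: pmf_eq_0_set_pmf)
  qed
  show ?thesis
    unfolding sketch_joint_def pmf_bind inner by (simp add: measure_pmf_single)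
qed

text \<open>Joint masses are at most \<open>M * q\<close>, with \<open>M\<close> the largest mass of
  \<open>W\<close>. The factor \<open>M\<close> gives back the min-entropy of \<open>W\<close>; the
  loss is what the size of the output set exceeds the randomness \<open>1 / q\<close> spent by the
  sketch, in bits.\<close>

lemma has_entropy_loss_log_card:
  assumes fin: "finite B" and q: "q > 0"
    and supp: "\<And>w. w \<in> words n \<Longrightarrow> set_pmf (SS w) \<subseteq> B"
    and le: "\<And>w s. w \<in> words n \<Longrightarrow> pmf (SS w) s \<le> q"
  shows "has_entropy_loss n SS (log 2 (real (card B) * q))"
  unfolding has_entropy_loss_def
proof (intro allI impI)
  fix m :: real and W
  assume W: "set_pmf W \<subseteq> words n" and m: "m \<le> min_entropy W"
  define M where "M = (SUP a. pmf W a)"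
  have M: "pmf W a \<le> M" for a
    unfolding M_def by (rule cSUP_upper) (auto intro!: bdd_aboveI[of _ 1] pmf_le_1)
  obtain w0 where w0: "w0 \<in> set_pmf W" using set_pmf_not_empty[of W] by blast
  then have M0: "M > 0" using M[of w0] by (meson less_le_trans pmf_positive)
  have "set_pmf (SS w0) \<noteq> {}" by (rule set_pmf_not_empty)
  then have cB: "card B > 0" using supp[of w0] w0 W fin by (auto simp: card_gt_0_iff)
  have "avg_min_entropy (sketch_joint W SS) \<ge> - log 2 (real (card B) * (M * q))"
  proof (rule avg_min_entropy_ge[OF fin])
    show "snd ` set_pmf (sketch_joint W SS) \<subseteq> B"
      using W supp by (fastforce simp: sketch_joint_def)
    show "pmf (sketch_joint W SS) (w, s) \<le> M * q" for w s
    proof (cases "w \<in> words n")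
      case True
      then show ?thesis
        unfolding pmf_sketch_joint using M M0 le by (intro mult_mono) auto
    next
      case False
      then have "pmf W w = 0" using W by (auto simp: pmf_eq_0_set_pmf)
      then show ?thesis using M0 q by (simp add: pmf_sketch_joint)
    qed
  qed
  moreover have "log 2 (real (card B) * (M * q)) = log 2 M + log 2 (real (card B) * q)"
    using M0 q cB by (simp add: log_mult)
  ultimately show "m - log 2 (real (card B) * q) \<le> avg_min_entropy (sketch_joint W SS)"
    using m by (simp add: min_entropy_def M_def)
qed

section \<open>Volume of Hamming balls\<close>

text \<open>Counting sets of flipped positions instead of words makes the volume independent of a
  centre.\<close>

definition ball_volume :: "nat \<Rightarrow> nat \<Rightarrow> nat" where
  "ball_volume n t = card {S. S \<subseteq> {..<n} \<and> card S \<le> t}"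

lemma ball_volume_pos: "ball_volume n t > 0"
proof -
  have "finite {S. S \<subseteq> {..<n} \<and> card S \<le> t}" by simp
  moreover have "{} \<in> {S. S \<subseteq> {..<n} \<and> card S \<le> t}" by simp
  ultimately show ?thesis unfolding ball_volume_def by (metis card_gt_0_iff empty_iff)
qed

lemma finite_words [simp]: "finite (words n)"
  using finite_lists_length_eq[of "UNIV :: bool set" n] by (simp add: words_def)

text \<open>Over a binary alphabet, a word is determined by the positions where it differs from
  \<open>w\<close>.\<close>

lemma card_hamming_ball_le:
  "card {x \<in> words n. hamming x w \<le> t} \<le> ball_volume n t"
  unfolding ball_volume_def
proof (rule card_inj_on_le)
  let ?D = "\<lambda>x. {i. i < n \<and> x ! i \<noteq> w ! i}"
  show "inj_on ?D {x \<in> words n. hamming x w \<le> t}"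
  proof (rule inj_onI)
    fix x y
    assume "x \<in> {x \<in> words n. hamming x w \<le> t}" "y \<in> {x \<in> words n. hamming x w \<le> t}"
      and eq: "?D x = ?D y"
    then have "length x = n" "length y = n" by (auto simp: words_def)
    moreover have "x ! i = y ! i" if "i < n" for i
      using eq that by (cases "x ! i"; cases "y ! i"; cases "w ! i") blast+
    ultimately show "x = y" by (simp add: list_eq_iff_nth_eq)
  qed
  show "?D ` {x \<in> words n. hamming x w \<le> t} \<subseteq> {S. S \<subseteq> {..<n} \<and> card S \<le> t}"
    by (auto simp: words_def hamming_def)
qed simp

text \<open>Flip each position independently with probability \<open>p = t / n\<close>. Every error
  set of size at most \<open>t\<close> then has probability at least
  \<open>p ^ t * (1 - p) ^ (n - t)\<close>, which is 2 to the power
  \<open>- n * bin_entropy p\<close>, and the probabilities sum to 1.\<close>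

lemma log_ball_volume_le:
  assumes "0 < t" "real t < real n / 2"
  shows "log 2 (real (ball_volume n t)) \<le> real n * bin_entropy (real t / real n)"
proof -
  define p where "p = real t / real n"
  have n: "n > 0" and tn: "t \<le> n" using assms by auto
  have p: "0 < p" "p < 1 / 2" using assms n by (auto simp: p_def field_simps)
  let ?A = "{S. S \<subseteq> {..<n} \<and> card S \<le> t}"
  let ?f = "\<lambda>S. p ^ card S * (1 - p) ^ (n - card S)"
  have term_ge: "p ^ t * (1 - p) ^ (n - t) \<le> ?f S" if "S \<in> ?A" for S
  proof -
    let ?d = "card S"
    from that have d: "?d \<le> t" by simp
    have "p ^ t * (1 - p) ^ (n - t) = p ^ ?d * (p ^ (t - ?d) * (1 - p) ^ (n - t))"
      using d by (simp flip: power_add mult.assoc)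
    \<comment> \<open>Here \<open>p < 1 / 2\<close> enters, as \<open>p \<le> 1 - p\<close>.\<close>
    also have "\<dots> \<le> p ^ ?d * ((1 - p) ^ (t - ?d) * (1 - p) ^ (n - t))"
      using p by (intro mult_left_mono mult_right_mono power_mono) auto
    also have "\<dots> = ?f S" using d tn by (simp flip: power_add)
    finally show ?thesis .
  qed
  have "real (ball_volume n t) * (p ^ t * (1 - p) ^ (n - t)) \<le> sum ?f ?A"
    unfolding ball_volume_def by (rule sum_bounded_below) (rule term_ge)
  also have "\<dots> \<le> sum ?f (Pow {..<n})"
    using p by (intro sum_mono2) auto
  also have "\<dots> = (\<Sum>S\<in>Pow {..<n}. (\<Prod>i\<in>S. p) * (\<Prod>i\<in>{..<n} - S. 1 - p))"
    by (intro sum.cong) (auto simp: card_Diff_subset finite_subset)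
  \<comment> \<open>The sum is the expansion of the product of \<open>n\<close> factors
    \<open>p + (1 - p)\<close>.\<close>
  also have "\<dots> = 1"
    by (subst prod_add[symmetric]) auto
  finally have "real (ball_volume n t) * (p ^ t * (1 - p) ^ (n - t)) \<le> 1" .
  then have "log 2 (real (ball_volume n t) * (p ^ t * (1 - p) ^ (n - t))) \<le> 0"
    using p ball_volume_pos[of n t] by simp
  then have "log 2 (real (ball_volume n t)) + real t * log 2 p + real (n - t) * log 2 (1 - p) \<le> 0"
    using p ball_volume_pos[of n t] by (simp add: log_mult log_nat_power)
  moreover have "real n * bin_entropy p = - real t * log 2 p - real (n - t) * log 2 (1 - p)"
    using n tn by (simp add: bin_entropy_def p_def field_simps of_nat_diff)
  ultimately show ?thesis by (simp add: p_def)
qed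

section \<open>Random hashing\<close>

text \<open>A function with \<open>f x = f y\<close> is determined by its values off
  \<open>x\<close>, which leaves \<open>K ^ (card A - 1)\<close> choices. Thus a uniformly random
  function collides at \<open>x\<close> and \<open>y\<close> with probability at most
  \<open>1 / K\<close>.\<close>

lemma card_collisions_le:
  assumes "finite A" "x \<in> A" "y \<in> A" "x \<noteq> y"
  shows "card {f \<in> A \<rightarrow>\<^sub>E {..<K}. f x = f y} * K \<le> card (A \<rightarrow>\<^sub>E {..<K::nat})"
proof -
  have "card {f \<in> A \<rightarrow>\<^sub>E {..<K}. f x = f y} \<le> card (A - {x} \<rightarrow>\<^sub>E {..<K})"
  proof (rule card_inj_on_le)
    show "inj_on (\<lambda>f. restrict f (A - {x})) {f \<in> A \<rightarrow>\<^sub>E {..<K}. f x = f y}"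
    proof (rule inj_onI, rule ext)
      fix f g z
      assume f: "f \<in> {f \<in> A \<rightarrow>\<^sub>E {..<K}. f x = f y}" and g: "g \<in> {f \<in> A \<rightarrow>\<^sub>E {..<K}. f x = f y}"
        and eq: "restrict f (A - {x}) = restrict g (A - {x})"
      have agree: "f v = g v" if "v \<in> A - {x}" for v
        using fun_cong[OF eq, of v] that by simp
      consider "z \<in> A - {x}" | "z = x" | "z \<notin> A" by blast
      then show "f z = g z"
      proof cases
        case 2
        then show ?thesis using f g agree[of y] assms by simp
      next
        \<comment> \<open>Outside \<open>A\<close> both functions are \<open>undefined\<close> by
          extensionality.\<close>
        case 3
        have "f \<in> A \<rightarrow>\<^sub>E {..<K}" "g \<in> A \<rightarrow>\<^sub>E {..<K}" using f g by auto
        from this[THEN PiE_arb, OF 3] show ?thesis by simp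
      qed (rule agree)
    qed
    show "(\<lambda>f. restrict f (A - {x})) ` {f \<in> A \<rightarrow>\<^sub>E {..<K}. f x = f y} \<subseteq> (A - {x} \<rightarrow>\<^sub>E {..<K})"
      by (intro image_subsetI restrict_PiE_iff[THEN iffD2]) (auto dest: PiE_mem)
    show "finite (A - {x} \<rightarrow>\<^sub>E {..<K})" using assms by (intro finite_PiE) auto
  qed
  then have "card {f \<in> A \<rightarrow>\<^sub>E {..<K}. f x = f y} * K \<le> K ^ (card A - 1) * K"
    using assms by (simp add: card_PiE)
  also have "\<dots> = K ^ card A"
    using assms by (metis card_gt_0_iff empty_iff power_minus_mult)
  finally show ?thesis using assms by (simp add: card_PiE)
qed

lemma hashing_sketch_exists:
  assumes K: "K > 0"
  shows "\<exists>SS Rec. Rec \<in> words n \<rightarrow> UNIV \<rightarrow> words n \<and>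
    has_entropy_loss n SS (log 2 (real K)) \<and>
    corrects_input_dependent n t SS Rec (real (ball_volume n t) / real K)"
proof -
  define F where "F = (words n \<rightarrow>\<^sub>E {..<K})"
  have finF: "finite F" unfolding F_def by (intro finite_PiE) auto
  have neF: "F \<noteq> {}" unfolding F_def using K by (auto simp: PiE_eq_empty_iff)
  have cF: "card F > 0" using finF neF by (simp add: card_gt_0_iff)
  define C where "C = F \<times> {..<K}"
  have finC: "finite C" unfolding C_def using finF by simp
  \<comment> \<open>Sketches have to be bit strings, of any length: number the finite set
    \<open>C\<close> and write the number in unary.\<close>
  define enc where "enc c = replicate (to_nat_on C c) True" for c
  have inj: "inj_on enc C"
    unfolding enc_def
    by (rule inj_onI) (auto dest: inj_onD[OF inj_on_to_nat_on[OF countable_finite[OF finC]]])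
  define dec where "dec = inv_into C enc"
  define SS where "SS w = map_pmf (\<lambda>f. enc (f, f w)) (pmf_of_set F)" for w
  define cand where
    "cand w' s x \<longleftrightarrow> x \<in> words n \<and> hamming x w' \<le> t \<and> fst (dec s) x = snd (dec s)" for w' s x
  \<comment> \<open>The default \<open>w'\<close> keeps the output among the words of length
    \<open>n\<close> when no candidate exists.\<close>
  define Rec where "Rec w' s = (if \<exists>x. cand w' s x then SOME x. cand w' s x else w')" for w' s
  have in_C: "(f, f w) \<in> C" if "f \<in> F" "w \<in> words n" for f w
    using that by (auto simp: C_def F_def)
  have "Rec w' s \<in> words n" if "w' \<in> words n" for w' s
    using that someI_ex[of "cand w' s"] by (auto simp: Rec_def cand_def)
  then have Rec_words: "Rec \<in> words n \<rightarrow> UNIV \<rightarrow> words n" by auto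
  have "has_entropy_loss n SS (log 2 (real (card (enc ` C)) * (1 / real (card F))))"
  proof (rule has_entropy_loss_log_card)
    fix w assume w: "w \<in> words n"
    show "set_pmf (SS w) \<subseteq> enc ` C"
      using in_C[OF _ w] finF neF by (auto simp: SS_def)
    fix s
    \<comment> \<open>The sketch reveals \<open>f\<close>, so each output arises from at most one
      choice of coins.\<close>
    have "F \<inter> {f. enc (f, f w) = s} \<subseteq> {fst (dec s)}"
      using in_C[OF _ w] inj by (auto simp: dec_def inv_into_f_f)
    then have "card (F \<inter> {f. enc (f, f w) = s}) \<le> card {fst (dec s)}"
      by (intro card_mono) auto
    then show "pmf (SS w) s \<le> 1 / real (card F)"
      using cF finF neF
      by (simp add: SS_def pmf_map vimage_def measure_pmf_of_set divide_right_mono)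
  qed (use finC cF in auto)
  moreover have "real (card (enc ` C)) * (1 / real (card F)) = real K"
    unfolding card_image[OF inj] using cF by (simp add: C_def card_cartesian_product)
  ultimately have loss: "has_entropy_loss n SS (log 2 (real K))" by simp
  have "corrects_input_dependent n t SS Rec (real (ball_volume n t) / real K)"
    unfolding corrects_input_dependent_def
  proof (intro ballI impI)
    fix w w' assume w: "w \<in> words n" and w': "w' \<in> words n" and d: "hamming w w' \<le> t"
    let ?ball = "{x \<in> words n. hamming x w' \<le> t}"
    let ?coll = "\<lambda>x. {f \<in> F. f x = f w}"
    define bad where "bad = {f. Rec w' (enc (f, f w)) \<noteq> w}"
    \<comment> \<open>Since \<open>w\<close> itself is a candidate, a failed decoding returns
      another candidate, which collides with \<open>w\<close>. The ball is fixed before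
      \<open>f\<close> is drawn, because \<open>w'\<close> does not depend on the coins; hence a
      union bound over it applies.\<close>
    have sub: "F \<inter> bad \<subseteq> (\<Union>x\<in>?ball - {w}. ?coll x)"
    proof
      fix f assume f: "f \<in> F \<inter> bad"
      let ?s = "enc (f, f w)"
      have dec: "dec ?s = (f, f w)" using f in_C[OF _ w] inj by (auto simp: dec_def inv_into_f_f)
      have ex: "cand w' ?s w" using dec w d by (simp add: cand_def)
      then have "cand w' ?s (Rec w' ?s)" by (auto simp: Rec_def intro: someI)
      then show "f \<in> (\<Union>x\<in>?ball - {w}. ?coll x)"
        using f dec by (auto simp: cand_def bad_def intro!: bexI[of _ "Rec w' ?s"])
    qed
    have coll: "real (card (?coll x)) \<le> real (card F) / real K" if "x \<in> ?ball - {w}" for x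
    proof -
      have "card (?coll x) * K \<le> card F"
        unfolding F_def using that w by (intro card_collisions_le) auto
      then have "real (card (?coll x)) * real K \<le> real (card F)"
        by (simp only: of_nat_le_iff flip: of_nat_mult)
      then show ?thesis using K by (simp add: field_simps)
    qed
    have "card (F \<inter> bad) \<le> card (\<Union>x\<in>?ball - {w}. ?coll x)"
      using finF by (intro card_mono[OF _ sub]) auto
    also have "\<dots> \<le> (\<Sum>x\<in>?ball - {w}. card (?coll x))"
      by (rule card_UN_le) simp
    finally have "real (card (F \<inter> bad)) \<le> (\<Sum>x\<in>?ball - {w}. real (card (?coll x)))"
      by (simp flip: of_nat_sum)
    also have "\<dots> \<le> real (card (?ball - {w})) * (real (card F) / real K)"
      using coll by (rule sum_bounded_above)
    also have "\<dots> \<le> real (ball_volume n t) * (real (card F) / real K)"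
    proof (rule mult_right_mono)
      have "card (?ball - {w}) \<le> card ?ball" by (intro card_mono) auto
      then show "real (card (?ball - {w})) \<le> real (ball_volume n t)"
        using card_hamming_ball_le[of n w' t] by linarith
    qed simp
    finally have "measure_pmf.prob (pmf_of_set F) bad \<le> real (ball_volume n t) / real K"
      using cF finF neF by (simp add: measure_pmf_of_set field_simps)
    moreover have "\<P>(s in measure_pmf (SS w). Rec w' s = w) = 1 - measure_pmf.prob (pmf_of_set F) bad"
    proof -
      have "\<P>(s in measure_pmf (SS w). Rec w' s = w) = measure_pmf.prob (pmf_of_set F) (- bad)"
        by (simp add: SS_def bad_def vimage_def Compl_eq)
      also have "\<dots> = 1 - measure_pmf.prob (pmf_of_set F) bad"
        using measure_pmf.prob_compl[of bad "pmf_of_set F"] by (simp add: Compl_eq_Diff_UNIV)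
      finally show ?thesis .
    qed
    ultimately show "1 - real (ball_volume n t) / real K \<le> \<P>(s in measure_pmf (SS w). Rec w' s = w)"
      by simp
  qed
  with Rec_words loss show ?thesis by blast
qed

section \<open>Choice of the hash range and asymptotics\<close>

lemma has_entropy_loss_mono:
  "has_entropy_loss n SS l \<Longrightarrow> l \<le> l' \<Longrightarrow> has_entropy_loss n SS l'"
  unfolding has_entropy_loss_def by (meson diff_left_mono order_trans)

text \<open>The threshold 3 is the least \<open>n\<close> for which an integer lies strictly between
  0 and \<open>n / 2\<close>.\<close>

theorem mainTheorem15:
  fixes t :: "nat \<Rightarrow> nat"
  assumes "\<And>n. n \<ge> 3 \<Longrightarrow> 0 < t n \<and> real (t n) < real n / 2"
  shows "\<exists>(SS :: nat \<Rightarrow> bool list \<Rightarrow> bool list pmf)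
          (Rec :: nat \<Rightarrow> bool list \<Rightarrow> bool list \<Rightarrow> bool list)
          (\<delta> :: nat \<Rightarrow> real) (\<epsilon> :: nat \<Rightarrow> real).
       \<delta> \<in> o(\<lambda>n. 1) \<and> \<epsilon> \<in> o(\<lambda>n. 1) \<and>
       (\<forall>n\<ge>3. Rec n \<in> words n \<rightarrow> UNIV \<rightarrow> words n \<and>
          has_entropy_loss n (SS n) (real n * (bin_entropy (real (t n) / real n) + \<delta> n)) \<and>
          corrects_input_dependent n (t n) (SS n) (Rec n) (\<epsilon> n))"
proof -
  define \<delta> where "\<delta> n = log 2 (real n) / real n" for n :: nat
  define \<epsilon> where "\<epsilon> n = 1 / real n" for n :: nat
  \<comment> \<open>With \<open>n \<ge> 3\<close> inside the existential, the claim holds for every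
    \<open>n\<close>, and choice yields whole sequences of sketches.\<close>
  have "\<exists>SS Rec. n \<ge> 3 \<longrightarrow> Rec \<in> words n \<rightarrow> UNIV \<rightarrow> words n \<and>
      has_entropy_loss n SS (real n * (bin_entropy (real (t n) / real n) + \<delta> n)) \<and>
      corrects_input_dependent n (t n) SS Rec (\<epsilon> n)" for n
  proof (cases "n \<ge> 3")
    case True
    let ?V = "ball_volume n (t n)"
    have V: "?V > 0" by (rule ball_volume_pos)
    have "log 2 (real (n * ?V)) = log 2 (real n) + log 2 (real ?V)"
      using V True by (simp add: log_mult)
    also have "\<dots> \<le> real n * (bin_entropy (real (t n) / real n) + \<delta> n)"
      using log_ball_volume_le[of "t n" n] assms[OF True] True
      by (simp add: \<delta>_def distrib_left)
    finally have "log 2 (real (n * ?V)) \<le> real n * (bin_entropy (real (t n) / real n) + \<delta> n)" .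
    moreover have "real ?V / real (n * ?V) = \<epsilon> n" using V by (simp add: \<epsilon>_def)
    moreover have "n * ?V > 0" using V True by simp
    ultimately show ?thesis
      using hashing_sketch_exists[of "n * ?V" n "t n"] by (metis (no_types) has_entropy_loss_mono)
  qed simp
  then obtain SS Rec where "\<forall>n\<ge>3. Rec n \<in> words n \<rightarrow> UNIV \<rightarrow> words n \<and>
      has_entropy_loss n (SS n) (real n * (bin_entropy (real (t n) / real n) + \<delta> n)) \<and>
      corrects_input_dependent n (t n) (SS n) (Rec n) (\<epsilon> n)"
    by metis
  moreover have "\<delta> \<in> o(\<lambda>n. 1)" unfolding \<delta>_def by real_asymp
  moreover have "\<epsilon> \<in> o(\<lambda>n. 1)" unfolding \<epsilon>_def by real_asymp
  ultimately show ?thesis by blast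
qed

end
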